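(* Let $\psi=g+\pi$ on $\mathbb{R}^d$ with $g$ convex and generalized smooth and $\pi$ $\mu$-strongly convex with $\mu>0$, and let $x^\star$ be the minimizer of $\psi$. Run AGLS (described in the context) with $\alpha_1=\sqrt{\frac{\mu}{\hat L_1+\mu}}$ and the remaining parameters chosen as in the context, and suppose that the line search succeeds for all $t=1,\dots,T$. Then all the iterates $x^t,y^t,z^t$ of AGLS remain in $\mathcal{B}_{D_2^\star}(x^\star)=\{x:\|x-x^\star\|\le D_2^\star\}$, where $D_2^\star:=\sqrt{\frac2\mu[\psi(x^0)-\psi(x^\star)]+\|x^0-x^\star\|^2}$. Moreover, $$\psi(y^T)-\psi(x^\star)+\frac\mu2\|z^T-x^\star\|^2\le\prod_{1\le t\le T}\left(1-\sqrt{\frac{\mu}{\hat L_t+\mu}}\right)\left[\psi(x^0)-\psi(x^\star)+\frac\mu2\|x^0-x^\star\|^2\right]$$ $$\le2\exp\left(-\sqrt{\frac{\mu}{\tau_uL_2^\star+\mu}}\;T\right)[\psi(x^0)-\psi(x^\star)],$$ where $L_2^\star=\sup\{2\mathcal{L}(x,y):x,y\in\mathcal{B}_{D_2^\star}(x^\star)\}$.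
   Context: Setting. $\pi:\mathbb{R}^d\to(-\infty,+\infty]$ is proper, lower semicontinuous and $\mu$-strongly convex. $g:\mathbb{R}^d\to\mathbb{R}$ is convex, differentiable and generalized smooth: $\|\nabla g(y)-\nabla g(x)\|\le\mathcal{L}(x,y)\|y-x\|$ for all $x,y$, with $\mathcal{L}:\mathbb{R}^d\times\mathbb{R}^d\to(0,\infty)$ symmetric and continuous. AGLS (accelerated gradient method with line search, no early stop). Inputs: $x^0\in\operatorname{dom}\pi$, $\mu$, $L_0\in(0,\infty)$, $\tau_d\in(0,1)$, $\tau_u\in(1,\infty)$. Set $y^0=z^0=x^0$, $\hat L_0=L_0$. For $t=1,\dots,T$: let $\bar L_t=\tau_d\hat L_{t-1}$ and let $k_t$ be the smallest nonnegative integer such that, with $\hat L_t=\bar L_t\tau_u^{k_t}$, the points $$x^t=(1-\alpha_t)y^{t-1}+\alpha_t((1-\beta_t)y^{t-1}+\beta_tz^{t-1}),$$ $$z^t=\arg\min_x\{\langle\nabla g(x^t),x\rangle+\pi(x)+\tfrac{\gamma_t}{2}\|x-z^{t-1}\|^2\},\qquad y^t=(1-\alpha_t)y^{t-1}+\alpha_tz^t$$ satisfy $g(y^t)\le g(x^t)+\langle\nabla g(x^t),y^t-x^t\rangle+\frac{\hat L_t}{2}\|y^t-x^t\|^2$. The line search "succeeds" at $t$ if such a $k_t$ exists. Parameter choice: $\gamma_t=(\hat L_t+\mu)\alpha_t-\mu$, $\beta_t=\frac{\gamma_t}{\hat L_t\alpha_t}$, and for $t\ge2$, $\alpha_t\in(0,1)$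 is the solution of $(\hat L_t+\mu)\alpha_t^2+(b_{t-1}-\mu)\alpha_t-b_{t-1}=0$, where $b_t=\alpha_t^2(\hat L_t+\mu)$.
   Formalization: The second inequality (the exponential bound) is proved under the added condition τ_d L_0 ≤ τ_u L_2^⋆; for arbitrary L_0 > 0 it is false, since \hat L_1 ≥ τ_d L_0 may be far larger than τ_u L_2^⋆. *)

theory Defs
  imports "HOL-Analysis.Analysis"
begin

section \<open>Extended-valued convex analysis\<close>

definition proper :: "('a \<Rightarrow> ereal) \<Rightarrow> bool" where
  "proper f \<longleftrightarrow> (\<forall>x. f x \<noteq> -\<infinity>) \<and> (\<exists>x. f x \<noteq> \<infinity>)"

definition edom :: "('a \<Rightarrow> ereal) \<Rightarrow> 'a set" where
  "edom f = {x. f x < \<infinity>}"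

definition lower_semicontinuous :: "('a::topological_space \<Rightarrow> ereal) \<Rightarrow> bool" where
  "lower_semicontinuous f \<longleftrightarrow> (\<forall>x. f x \<le> Liminf (at x) f)"

text \<open>The weight \<open>l\<close> ranges over the open unit interval, so that \<open>0 * \<infinity>\<close> does not occur.\<close>

definition strongly_convex :: "real \<Rightarrow> ('a::real_inner \<Rightarrow> ereal) \<Rightarrow> bool" where
  "strongly_convex \<mu> f \<longleftrightarrow>
     (\<forall>x y. \<forall>l\<in>{0<..<1}.
        f ((1 - l) *\<^sub>R x + l *\<^sub>R y)
          \<le> ereal (1 - l) * f x + ereal l * f y - ereal (\<mu> / 2 * l * (1 - l) * (norm (x - y))\<^sup>2))"

text \<open>\<open>G\<close> is the gradient map of \<open>g\<close>, and \<open>\<L> x y\<close> bounds the Lipschitz quotient of \<open>G\<close> at the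
  pair \<open>x\<close>, \<open>y\<close>.\<close>

definition generalized_smooth ::
    "('a::euclidean_space \<Rightarrow> real) \<Rightarrow> ('a \<Rightarrow> 'a) \<Rightarrow> ('a \<Rightarrow> 'a \<Rightarrow> real) \<Rightarrow> bool" where
  "generalized_smooth g G \<L> \<longleftrightarrow>
     (\<forall>x. GDERIV g x :> G x) \<and>
     (\<forall>x y. \<L> x y > 0) \<and>
     (\<forall>x y. \<L> x y = \<L> y x) \<and>
     continuous_on UNIV (\<lambda>(x, y). \<L> x y) \<and>
     (\<forall>x y. norm (G y - G x) \<le> \<L> x y * norm (y - x))"


section \<open>The accelerated gradient method with line search\<close>

text \<open>State after iteration \<open>t\<close>: the points \<open>x\<^sup>t\<close>, \<open>y\<^sup>t\<close>, \<open>z\<^sup>t\<close>, the local Lipschitz estimate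
  \<open>L\<^sub>t\<close> (with a hat in the usual notation) and the number \<open>b\<^sub>t = \<alpha>\<^sub>t\<^sup>2 (L\<^sub>t + \<mu>)\<close>.\<close>

record 'a agls_state =
  st_x :: 'a
  st_y :: 'a
  st_z :: 'a
  st_L :: real
  st_b :: real

text \<open>The parameters of iteration \<open>t\<close> depend on the trial value \<open>L\<close> of the Lipschitz estimate, hence
  are recomputed at each step of the line search. The rule for the first step is an argument
  \<open>\<alpha>1\<close>, a function of \<open>L\<close>; \<open>b\<close> stands for \<open>b\<^sub>t\<^sub>-\<^sub>1\<close> and is only used for \<open>t \<ge> 2\<close>.\<close>

definition agls_alpha :: "(real \<Rightarrow> real) \<Rightarrow> real \<Rightarrow> nat \<Rightarrow> real \<Rightarrow> real \<Rightarrow> real" where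
  "agls_alpha \<alpha>1 \<mu> t b L =
     (if t = 1 then \<alpha>1 L
      else (THE a. 0 < a \<and> a < 1 \<and> (L + \<mu>) * a\<^sup>2 + (b - \<mu>) * a - b = 0))"

definition agls_gamma :: "real \<Rightarrow> real \<Rightarrow> real \<Rightarrow> real" where
  "agls_gamma \<mu> L a = (L + \<mu>) * a - \<mu>"

definition agls_beta :: "real \<Rightarrow> real \<Rightarrow> real \<Rightarrow> real" where
  "agls_beta \<mu> L a = agls_gamma \<mu> L a / (L * a)"

text \<open>The points of iteration \<open>t\<close>, started from the state \<open>s\<close> after iteration \<open>t - 1\<close>, for the trial
  value \<open>L\<close>.\<close>

definition agls_trial ::
    "('a::euclidean_space \<Rightarrow> 'a) \<Rightarrow> ('a \<Rightarrow> ereal) \<Rightarrow> real \<Rightarrow> (real \<Rightarrow> real) \<Rightarrow>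
     nat \<Rightarrow> 'a agls_state \<Rightarrow> real \<Rightarrow> 'a agls_state" where
  "agls_trial G \<pi> \<mu> \<alpha>1 t s L =
    (let a = agls_alpha \<alpha>1 \<mu> t (st_b s) L;
         \<gamma> = agls_gamma \<mu> L a;
         \<beta> = agls_beta \<mu> L a;
         x = (1 - a) *\<^sub>R st_y s + a *\<^sub>R ((1 - \<beta>) *\<^sub>R st_y s + \<beta> *\<^sub>R st_z s);
         z = (ARG_MIN (\<lambda>u. ereal (G x \<bullet> u) + \<pi> u + ereal (\<gamma> / 2 * (norm (u - st_z s))\<^sup>2)) u. True);
         y = (1 - a) *\<^sub>R st_y s + a *\<^sub>R z
     in \<lparr>st_x = x, st_y = y, st_z = z, st_L = L, st_b = a\<^sup>2 * (L + \<mu>)\<rparr>)"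

definition agls_accept ::
    "('a::euclidean_space \<Rightarrow> real) \<Rightarrow> ('a \<Rightarrow> 'a) \<Rightarrow> 'a agls_state \<Rightarrow> bool" where
  "agls_accept g G s \<longleftrightarrow>
     g (st_y s) \<le> g (st_x s) + G (st_x s) \<bullet> (st_y s - st_x s)
                   + st_L s / 2 * (norm (st_y s - st_x s))\<^sup>2"

text \<open>The \<open>k\<close>-th trial of the line search in iteration \<open>t\<close>.\<close>

definition agls_search ::
    "('a::euclidean_space \<Rightarrow> 'a) \<Rightarrow> ('a \<Rightarrow> ereal) \<Rightarrow> real \<Rightarrow> real \<Rightarrow> real \<Rightarrow> (real \<Rightarrow> real) \<Rightarrow>
     nat \<Rightarrow> 'a agls_state \<Rightarrow> nat \<Rightarrow> 'a agls_state" where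
  "agls_search G \<pi> \<mu> \<tau>\<^sub>d \<tau>\<^sub>u \<alpha>1 t s k = agls_trial G \<pi> \<mu> \<alpha>1 t s (\<tau>\<^sub>d * st_L s * \<tau>\<^sub>u ^ k)"

text \<open>The state after \<open>t\<close> iterations. It is meaningful only as long as the line search succeeds;
  see \<open>agls_succeeds\<close>. The component \<open>st_b\<close> of the initial state is never used.\<close>

primrec agls ::
    "('a::euclidean_space \<Rightarrow> real) \<Rightarrow> ('a \<Rightarrow> 'a) \<Rightarrow> ('a \<Rightarrow> ereal) \<Rightarrow> real \<Rightarrow> real \<Rightarrow> real \<Rightarrow> real \<Rightarrow>
     (real \<Rightarrow> real) \<Rightarrow> 'a \<Rightarrow> nat \<Rightarrow> 'a agls_state" where
  "agls g G \<pi> \<mu> L0 \<tau>\<^sub>d \<tau>\<^sub>u \<alpha>1 x0 0 = \<lparr>st_x = x0, st_y = x0, st_z = x0, st_L = L0, st_b = 0\<rparr>"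
| "agls g G \<pi> \<mu> L0 \<tau>\<^sub>d \<tau>\<^sub>u \<alpha>1 x0 (Suc t) =
    (let search = agls_search G \<pi> \<mu> \<tau>\<^sub>d \<tau>\<^sub>u \<alpha>1 (Suc t) (agls g G \<pi> \<mu> L0 \<tau>\<^sub>d \<tau>\<^sub>u \<alpha>1 x0 t)
     in search (LEAST k. agls_accept g G (search k)))"

definition agls_succeeds ::
    "('a::euclidean_space \<Rightarrow> real) \<Rightarrow> ('a \<Rightarrow> 'a) \<Rightarrow> ('a \<Rightarrow> ereal) \<Rightarrow> real \<Rightarrow> real \<Rightarrow> real \<Rightarrow> real \<Rightarrow>
     (real \<Rightarrow> real) \<Rightarrow> 'a \<Rightarrow> nat \<Rightarrow> bool" where
  "agls_succeeds g G \<pi> \<mu> L0 \<tau>\<^sub>d \<tau>\<^sub>u \<alpha>1 x0 t \<longleftrightarrow>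
     (\<exists>k. agls_accept g G
            (agls_search G \<pi> \<mu> \<tau>\<^sub>d \<tau>\<^sub>u \<alpha>1 t (agls g G \<pi> \<mu> L0 \<tau>\<^sub>d \<tau>\<^sub>u \<alpha>1 x0 (t - 1)) k))"


section \<open>The constants of the linear rate\<close>

text \<open>Both values of \<open>\<psi>\<close> are finite when \<open>x0\<close> lies in the effective domain and \<open>xs\<close> minimizes
  \<open>\<psi>\<close>, so that \<open>real_of_ereal\<close> loses nothing.\<close>

definition D2_star :: "real \<Rightarrow> ('a::real_normed_vector \<Rightarrow> ereal) \<Rightarrow> 'a \<Rightarrow> 'a \<Rightarrow> real" where
  "D2_star \<mu> \<psi> x0 xs = sqrt (2 / \<mu> * real_of_ereal (\<psi> x0 - \<psi> xs) + (norm (x0 - xs))\<^sup>2)"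

definition L2_star :: "('a::real_normed_vector \<Rightarrow> 'a \<Rightarrow> real) \<Rightarrow> 'a \<Rightarrow> real \<Rightarrow> real" where
  "L2_star \<L> xs D = (SUP (x, y) \<in> cball xs D \<times> cball xs D. 2 * \<L> x y)"

end

theory Submission
  imports Defs
begin

text \<open>With \<open>\<alpha>\<^sub>1 = sqrt (\<mu> / (L\<^sub>1 + \<mu>))\<close> one gets \<open>b\<^sub>1 = \<mu>\<close>, and then the quadratic equation gives
  \<open>\<alpha>\<^sub>t = sqrt (\<mu> / (L\<^sub>t + \<mu>))\<close> and \<open>b\<^sub>t = \<mu>\<close> for all \<open>t\<close>. For this step size an accepted step contracts
  the energy \<open>\<psi> y\<^sub>t - \<psi> xs + \<mu>/2 \<parallel>z\<^sub>t - xs\<parallel>\<^sup>2\<close> by the factor \<open>1 - \<alpha>\<^sub>t\<close>, and the initial energy is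
  \<open>\<mu>/2 D\<^sup>2\<close>; since \<open>\<psi>\<close> grows quadratically around \<open>xs\<close>, the iterates stay in the ball. To bound
  \<open>L\<^sub>t\<close> one must show that every trial value \<open>L \<ge> L2\<close> is accepted, although the trial point is not known
  to lie in the ball beforehand. The proximal step constrained to the ball does lie there and passes
  the test by convexity and the Lipschitz bound on the gradient; the contraction then puts it in the
  open ball, so by convexity it is the unconstrained step.\<close>

section \<open>Lower semicontinuity and strong convexity\<close>

text \<open>The definition uses punctured neighbourhoods; the assumed inequality at \<open>x\<close>
  itself fills the gap, and the open sets obtained can serve in a covering argument.\<close>

lemma lower_semicontinuous_eventually_less:
  assumes "lower_semicontinuous f" "c < f x"
  shows "eventually (\<lambda>u. c < f u) (nhds x)"
proof -
  have "f x \<le> Liminf (at x) f"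
    using assms(1) by (simp add: lower_semicontinuous_def)
  then have "eventually (\<lambda>u. c < f u) (at x)"
    using assms(2) by (auto simp: le_Liminf_iff)
  then show ?thesis
    using assms(2) by (auto simp: eventually_at_filter elim: eventually_mono)
qed

lemma lower_semicontinuous_add_continuous:
  fixes h :: "'a::topological_space \<Rightarrow> real"
  assumes "lower_semicontinuous f" "continuous_on UNIV h"
    and "\<And>u. f u \<noteq> -\<infinity>"
  shows "lower_semicontinuous (\<lambda>u. ereal (h u) + f u)"
  unfolding lower_semicontinuous_def
proof
  fix x
  have "eventually (\<lambda>u. c < ereal (h u) + f u) (at x)" if c: "c < ereal (h x) + f x" for c
  proof (cases c)
    case (real r)
    then have "ereal (r - h x) < f x"
      using c by (cases "f x") auto
    \<comment> \<open>The slack between \<open>r\<close> and the sum is split at \<open>q\<close>: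
      near \<open>x\<close>, \<open>f\<close> stays above \<open>q\<close> and \<open>h\<close>
      above \<open>r - q\<close>.\<close>
    then obtain q where q: "r - h x < q" "ereal q < f x"
      using ereal_dense2 by (metis less_ereal.simps(1))
    have "eventually (\<lambda>u. ereal q < f u) (at x)"
      using lower_semicontinuous_eventually_less [OF assms(1) q(2)]
      by (auto simp: eventually_at_filter elim: eventually_mono)
    moreover have "(h \<longlongrightarrow> h x) (at x)"
      using assms(2) by (simp add: continuous_on_def)
    then have "eventually (\<lambda>u. r - q < h u) (at x)"
      using q(1) by (intro order_tendstoD(1)) auto
    ultimately show ?thesis
    proof eventually_elim
      fix u
      assume "ereal q < f u" "r - q < h u"
      then show "c < ereal (h u) + f u"
        using real by (cases "f u") auto
    qed
  next
    case MInf
    have "- \<infinity> < ereal (h u) + f u" for u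
      using assms(3) [of u] by (cases "f u") auto
    then show ?thesis
      using MInf by simp
  qed (use c in auto)
  then show "ereal (h x) + f x \<le> Liminf (at x) (\<lambda>u. ereal (h u) + f u)"
    by (simp add: le_Liminf_iff)
qed

text \<open>Weierstrass by compactness: otherwise each \<open>z\<close> has a strictly better point
  \<open>w z\<close>, and the neighbourhoods on which \<open>f\<close> exceeds
  \<open>f (w z)\<close> cover \<open>K\<close>. In a finite subcover the best of the points
  \<open>w z\<close> lies in some \<open>U v\<close>, hence is worse than \<open>w v\<close>, a
  contradiction.\<close>

lemma lower_semicontinuous_attains_inf:
  assumes "lower_semicontinuous f" "compact K" "K \<noteq> {}"
  shows "\<exists>z\<in>K. \<forall>u\<in>K. f z \<le> f u"
proof (rule ccontr)
  assume "\<not> ?thesis"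
  then have "\<forall>z\<in>K. \<exists>u\<in>K. f u < f z"
    by (auto simp: not_le)
  then obtain w where w: "\<And>z. z \<in> K \<Longrightarrow> w z \<in> K \<and> f (w z) < f z"
    by metis
  have "\<exists>U. open U \<and> z \<in> U \<and> (\<forall>u\<in>U. f (w z) < f u)" if "z \<in> K" for z
    using lower_semicontinuous_eventually_less [OF assms(1), of "f (w z)" z] w [OF that]
    by (auto simp: eventually_nhds)
  then obtain U where U: "\<And>z. z \<in> K \<Longrightarrow> open (U z) \<and> z \<in> U z \<and> (\<forall>u\<in>U z. f (w z) < f u)"
    by metis
  obtain C where C: "C \<subseteq> K" "finite C" "K \<subseteq> (\<Union>z\<in>C. U z)"
    using compactE_image [OF assms(2), of K U] U by blast
  then have "C \<noteq> {}"
    using assms(3) by auto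
  then have "Min ((\<lambda>v. f (w v)) ` C) \<in> (\<lambda>v. f (w v)) ` C"
    using C(2) by (intro Min_in) auto
  then obtain z where zC: "z \<in> C" "Min ((\<lambda>v. f (w v)) ` C) = f (w z)"
    by auto
  have z: "f (w z) \<le> f (w v)" if "v \<in> C" for v
    unfolding zC(2) [symmetric] using C(2) that by (intro Min_le) auto
  have "w z \<in> K"
    using zC(1) C(1) w by auto
  then obtain v where "v \<in> C" "w z \<in> U v"
    using C(3) by auto
  then have "f (w v) < f (w z)"
    using U C(1) by auto
  with z [OF \<open>v \<in> C\<close>] show False
    by simp
qed

lemma GDERIV_directional:
  assumes "GDERIV h z :> v"
  shows "((\<lambda>l. (h (z + l *\<^sub>R d) - h z) / l) \<longlongrightarrow> v \<bullet> d) (at_right 0)"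
proof -
  have "(h has_derivative (\<lambda>d. d \<bullet> v)) (at (z + 0 *\<^sub>R d))"
    using assms by (simp add: gderiv_def)
  moreover have "((\<lambda>l. z + l *\<^sub>R d) has_derivative (\<lambda>l. l *\<^sub>R d)) (at 0)"
    by (auto intro!: derivative_eq_intros)
  ultimately have "((\<lambda>l. h (z + l *\<^sub>R d)) has_derivative (\<lambda>l. (l *\<^sub>R d) \<bullet> v)) (at 0)"
    by (rule has_derivative_compose [rotated])
  moreover have "(\<lambda>l. (l *\<^sub>R d) \<bullet> v) = (*) (v \<bullet> d)"
    by (auto simp: inner_commute)
  ultimately have "((\<lambda>l. h (z + l *\<^sub>R d)) has_field_derivative (v \<bullet> d)) (at 0)"
    by (simp add: has_field_derivative_def)
  then have "((\<lambda>l. (h (z + l *\<^sub>R d) - h z) / l) \<longlongrightarrow> v \<bullet> d) (at 0)"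
    by (simp add: DERIV_def)
  then show ?thesis
    by (rule filterlim_mono) (auto simp: at_within_le_at)
qed

lemma convex_on_gradient_inequality:
  assumes "convex_on UNIV h" "GDERIV h z :> v"
  shows "h z + v \<bullet> (u - z) \<le> h u"
proof -
  have "eventually (\<lambda>l. (h (z + l *\<^sub>R (u - z)) - h z) / l \<le> h u - h z) (at_right 0)"
    using eventually_at_right_real [of 0 1]
  proof (rule eventually_mono)
    fix l :: real
    assume l: "l \<in> {0<..<1}"
    have "h (z + l *\<^sub>R (u - z)) = h ((1 - l) *\<^sub>R z + l *\<^sub>R u)"
      by (simp add: algebra_simps)
    also have "\<dots> \<le> (1 - l) * h z + l * h u"
      using l by (intro convex_onD [OF assms(1)]) auto
    finally have "h (z + l *\<^sub>R (u - z)) - h z \<le> (h u - h z) * l"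
      by (simp add: algebra_simps)
    then show "(h (z + l *\<^sub>R (u - z)) - h z) / l \<le> h u - h z"
      using l by (simp add: pos_divide_le_eq)
  qed simp
  then have "v \<bullet> (u - z) \<le> h u - h z"
    by (rule tendsto_upperbound [OF GDERIV_directional [OF assms(2)]]) simp
  then show ?thesis
    by simp
qed

text \<open>At two points of the effective domain the right-hand side of the definition is finite;
  this puts the intermediate point into the domain and permits real arithmetic.\<close>

lemma strongly_convex_real:
  assumes "proper f" "strongly_convex \<mu> f" "u \<in> edom f" "v \<in> edom f" "0 < l" "l < 1"
  shows "(1 - l) *\<^sub>R u + l *\<^sub>R v \<in> edom f"
    and "real_of_ereal (f ((1 - l) *\<^sub>R u + l *\<^sub>R v))
      \<le> (1 - l) * real_of_ereal (f u) + l * real_of_ereal (f v)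
         - \<mu> / 2 * l * (1 - l) * (norm (u - v))\<^sup>2"
proof -
  let ?w = "(1 - l) *\<^sub>R u + l *\<^sub>R v"
  obtain a b where ab: "f u = ereal a" "f v = ereal b"
    using assms unfolding proper_def edom_def by (cases "f u"; cases "f v"; force)
  have "f ?w \<le> ereal (1 - l) * f u + ereal l * f v - ereal (\<mu> / 2 * l * (1 - l) * (norm (u - v))\<^sup>2)"
    using assms unfolding strongly_convex_def by auto
  also have "\<dots> = ereal ((1 - l) * real_of_ereal (f u) + l * real_of_ereal (f v)
         - \<mu> / 2 * l * (1 - l) * (norm (u - v))\<^sup>2)"
    by (simp add: ab)
  finally have le: "f ?w \<le> \<dots>" .
  show "?w \<in> edom f"
    using le by (auto simp: edom_def intro: le_less_trans)
  then have "f ?w = ereal (real_of_ereal (f ?w))"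
    using assms(1) by (auto simp: proper_def edom_def ereal_real)
  with le show "real_of_ereal (f ?w) \<le> (1 - l) * real_of_ereal (f u) + l * real_of_ereal (f v)
         - \<mu> / 2 * l * (1 - l) * (norm (u - v))\<^sup>2"
    by (metis ereal_less_eq(3))
qed

text \<open>Compare \<open>z\<close> with \<open>z + l *\<^sub>R (u - z)\<close>, apply strong
  convexity, divide by \<open>l\<close> and let \<open>l\<close> tend to 0 from the right.
  Minimality is asked for only along the start of this one segment, so that minimizers over a convex
  set are covered too.\<close>

lemma strongly_convex_growth:
  assumes f: "proper f" "strongly_convex \<mu> f" and h: "GDERIV h z :> v"
    and dom: "z \<in> edom f" "u \<in> edom f"
    and min: "eventually (\<lambda>l. ereal (h z) + f z
        \<le> ereal (h (z + l *\<^sub>R (u - z))) + f (z + l *\<^sub>R (u - z))) (at_right 0)"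
  shows "real_of_ereal (f z) - v \<bullet> (u - z) + \<mu> / 2 * (norm (u - z))\<^sup>2 \<le> real_of_ereal (f u)"
proof -
  let ?r = "\<lambda>u. real_of_ereal (f u)"
  let ?B = "\<lambda>l. (h (z + l *\<^sub>R (u - z)) - h z) / l + ?r u - ?r z - \<mu> / 2 * (1 - l) * (norm (u - z))\<^sup>2"
  have "eventually (\<lambda>l. l \<in> {0<..<1::real}) (at_right 0)"
    by (rule eventually_at_right_real) simp
  with min have "eventually (\<lambda>l. 0 \<le> ?B l) (at_right 0)"
  proof eventually_elim
    fix l
    assume l: "l \<in> {0<..<1::real}"
      and le: "ereal (h z) + f z \<le> ereal (h (z + l *\<^sub>R (u - z))) + f (z + l *\<^sub>R (u - z))"
    have w: "z + l *\<^sub>R (u - z) = (1 - l) *\<^sub>R z + l *\<^sub>R u" (is "?w = _")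
      by (simp add: algebra_simps)
    have wd: "?w \<in> edom f"
      unfolding w using l by (intro strongly_convex_real(1) [OF f dom]) auto
    have "?r ?w \<le> (1 - l) * ?r z + l * ?r u - \<mu> / 2 * l * (1 - l) * (norm (z - u))\<^sup>2"
      unfolding w using l by (intro strongly_convex_real(2) [OF f dom]) auto
    moreover have "f z = ereal (?r z)" "f ?w = ereal (?r ?w)"
      using f dom wd by (auto simp: proper_def edom_def ereal_real)
    then have "h z + ?r z \<le> h ?w + ?r ?w"
      using le by (metis ereal_less_eq(3) plus_ereal.simps(1))
    ultimately have "0 \<le> h ?w - h z + l * (?r u - ?r z) - \<mu> / 2 * l * (1 - l) * (norm (u - z))\<^sup>2"
      by (simp add: algebra_simps norm_minus_commute)
    also have "\<dots> = l * ?B l"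
      using l by (simp add: field_simps)
    finally show "0 \<le> ?B l"
      using l by (simp add: zero_le_mult_iff)
  qed
  moreover have "(?B \<longlongrightarrow> v \<bullet> (u - z) + ?r u - ?r z - \<mu> / 2 * (1 - 0) * (norm (u - z))\<^sup>2) (at_right 0)"
    by (intro tendsto_intros GDERIV_directional h)
  ultimately have "0 \<le> v \<bullet> (u - z) + ?r u - ?r z - \<mu> / 2 * (1 - 0) * (norm (u - z))\<^sup>2"
    by (intro tendsto_lowerbound [where F = "at_right 0"]) auto
  then show ?thesis
    by simp
qed

lemma GDERIV_linear_plus_square:
  fixes c q z :: "'a::real_inner"
  shows "GDERIV (\<lambda>u. c \<bullet> u + \<gamma> / 2 * (norm (u - q))\<^sup>2) z :> c + \<gamma> *\<^sub>R (z - q)"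
  unfolding gderiv_def power2_norm_eq_inner
  by (auto intro!: derivative_eq_intros ext simp: algebra_simps inner_commute)

lemma half_square_expand:
  fixes u q z :: "'a::real_inner"
  shows "\<gamma> / 2 * (norm (u - q))\<^sup>2
    = \<gamma> / 2 * (norm (z - q))\<^sup>2 + \<gamma> * ((z - q) \<bullet> (u - z)) + \<gamma> / 2 * (norm (u - z))\<^sup>2"
proof -
  have "(norm (u - q))\<^sup>2 = (norm (z - q))\<^sup>2 + 2 * ((z - q) \<bullet> (u - z)) + (norm (u - z))\<^sup>2"
    by (simp add: power2_norm_eq_inner algebra_simps inner_commute)
  then show ?thesis
    by (simp only: distrib_left)
qed

section \<open>The composite objective and its quadratic growth\<close>

locale composite_problem =
  fixes g :: "'a::euclidean_space \<Rightarrow> real" and G :: "'a \<Rightarrow> 'a"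
    and \<pi> :: "'a \<Rightarrow> ereal" and \<L> :: "'a \<Rightarrow> 'a \<Rightarrow> real" and \<mu> :: real and xs :: 'a
  assumes g_convex: "convex_on UNIV g"
    and g_smooth: "generalized_smooth g G \<L>"
    and pi_proper: "proper \<pi>"
    and pi_lsc: "lower_semicontinuous \<pi>"
    and mu_pos: "\<mu> > 0"
    and pi_convex: "strongly_convex \<mu> \<pi>"
    and xs_min: "is_arg_min (\<lambda>u. ereal (g u) + \<pi> u) (\<lambda>_. True) xs"
begin

abbreviation p :: "'a \<Rightarrow> real" where
  "p u \<equiv> real_of_ereal (\<pi> u)"

lemma pi_eq: "u \<in> edom \<pi> \<Longrightarrow> \<pi> u = ereal (p u)"
  using pi_proper by (auto simp: proper_def edom_def ereal_real)

lemma pi_not_MInf: "\<pi> u \<noteq> -\<infinity>"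
  using pi_proper by (simp add: proper_def)

lemma pi_infinite: "u \<notin> edom \<pi> \<Longrightarrow> \<pi> u = \<infinity>"
  by (simp add: edom_def)

lemma G_gderiv: "GDERIV g u :> G u"
  using g_smooth by (simp add: generalized_smooth_def)

lemma xs_le: "ereal (g xs) + \<pi> xs \<le> ereal (g u) + \<pi> u"
  using xs_min by (simp add: is_arg_min_linorder)

lemma xs_dom: "xs \<in> edom \<pi>"
proof -
  obtain u where "\<pi> u \<noteq> \<infinity>"
    using pi_proper by (auto simp: proper_def)
  with xs_le [of u] show ?thesis
    using pi_not_MInf [of u] by (cases "\<pi> u"; cases "\<pi> xs") (auto simp: edom_def)
qed

text \<open>Optimality of \<open>xs\<close> makes \<open>- G xs\<close> a subgradient of \<pi> at
  \<open>xs\<close>; strong convexity adds the square.\<close>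

lemma xs_growth:
  "u \<in> edom \<pi> \<Longrightarrow> p xs - G xs \<bullet> (u - xs) + \<mu> / 2 * (norm (u - xs))\<^sup>2 \<le> p u"
  by (rule strongly_convex_growth [OF pi_proper pi_convex G_gderiv xs_dom])
    (auto intro: always_eventually xs_le)

text \<open>The linear terms in \<open>G xs\<close> cancel between \<open>xs_growth\<close> and the
  gradient inequality for \<open>g\<close>.\<close>

lemma objective_growth:
  assumes "u \<in> edom \<pi>"
  shows "g xs + p xs + \<mu> / 2 * (norm (u - xs))\<^sup>2 \<le> g u + p u"
  using xs_growth [OF assms] convex_on_gradient_inequality [OF g_convex G_gderiv, of xs u]
  by simp

section \<open>The proximal step\<close>

definition prox_obj :: "'a \<Rightarrow> real \<Rightarrow> 'a \<Rightarrow> 'a \<Rightarrow> ereal" where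
  "prox_obj c \<gamma> q u = ereal (c \<bullet> u) + \<pi> u + ereal (\<gamma> / 2 * (norm (u - q))\<^sup>2)"

text \<open>The first-order condition of the proximal problem:
  \<open>- (c + \<gamma> *\<^sub>R (z - q))\<close> is a subgradient of \<pi> at \<open>z\<close>,
  with the quadratic gain from strong convexity included.\<close>

definition prox_point :: "'a \<Rightarrow> real \<Rightarrow> 'a \<Rightarrow> 'a \<Rightarrow> bool" where
  "prox_point c \<gamma> q z \<longleftrightarrow> z \<in> edom \<pi> \<and>
     (\<forall>u\<in>edom \<pi>. p z - (c + \<gamma> *\<^sub>R (z - q)) \<bullet> (u - z) + \<mu> / 2 * (norm (u - z))\<^sup>2 \<le> p u)"

lemma prox_obj_eq:
  "prox_obj c \<gamma> q u = ereal (c \<bullet> u + \<gamma> / 2 * (norm (u - q))\<^sup>2) + \<pi> u"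
  unfolding prox_obj_def by (cases "\<pi> u") (auto simp: algebra_simps)

lemma prox_obj_finite:
  "u \<in> edom \<pi> \<Longrightarrow> prox_obj c \<gamma> q u = ereal (c \<bullet> u + \<gamma> / 2 * (norm (u - q))\<^sup>2 + p u)"
  unfolding prox_obj_eq by (subst pi_eq) auto

lemma prox_obj_infinite: "u \<notin> edom \<pi> \<Longrightarrow> prox_obj c \<gamma> q u = \<infinity>"
  unfolding prox_obj_eq by (simp add: pi_infinite)

lemma prox_obj_growth:
  assumes "z \<in> edom \<pi>" "u \<in> edom \<pi>"
    and "eventually (\<lambda>l. prox_obj c \<gamma> q z \<le> prox_obj c \<gamma> q (z + l *\<^sub>R (u - z))) (at_right 0)"
  shows "p z - (c + \<gamma> *\<^sub>R (z - q)) \<bullet> (u - z) + \<mu> / 2 * (norm (u - z))\<^sup>2 \<le> p u"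
  using assms(3) unfolding prox_obj_eq
  by (intro strongly_convex_growth [OF pi_proper pi_convex GDERIV_linear_plus_square assms(1,2)])

text \<open>The point \<open>xs\<close> in \<open>K\<close> supplies a finite value, which forces
  the minimizer into the effective domain.\<close>

lemma prox_obj_attains:
  assumes "compact K" "xs \<in> K"
  obtains z where "z \<in> K" "z \<in> edom \<pi>" "\<And>u. u \<in> K \<Longrightarrow> prox_obj c \<gamma> q z \<le> prox_obj c \<gamma> q u"
proof -
  have "lower_semicontinuous (prox_obj c \<gamma> q)"
    unfolding prox_obj_eq
    by (intro lower_semicontinuous_add_continuous pi_lsc continuous_intros pi_not_MInf)
  then obtain z where z: "z \<in> K" "\<forall>u\<in>K. prox_obj c \<gamma> q z \<le> prox_obj c \<gamma> q u"
    using lower_semicontinuous_attains_inf [of "prox_obj c \<gamma> q" K] assms by auto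
  then have "prox_obj c \<gamma> q z \<le> prox_obj c \<gamma> q xs"
    using assms(2) by auto
  also have "\<dots> < \<infinity>"
    by (simp add: prox_obj_finite xs_dom)
  finally have "z \<in> edom \<pi>"
    using prox_obj_infinite by force
  with z show ?thesis
    using that by auto
qed

text \<open>Expanding the square around \<open>z\<close> cancels all linear terms and leaves a
  multiple of the squared distance to \<open>z\<close> that is positive for \<open>u\<close> other
  than \<open>z\<close>. So the minimizer is unique and the choice in \<open>ARG_MIN\<close> is
  determined.\<close>

lemma prox_point_eq_ARG_MIN:
  assumes "prox_point c \<gamma> q z" "\<gamma> \<ge> 0"
  shows "(ARG_MIN (prox_obj c \<gamma> q) u. True) = z"
proof -
  have less: "prox_obj c \<gamma> q z < prox_obj c \<gamma> q u" if "u \<noteq> z" for u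
  proof (cases "u \<in> edom \<pi>")
    case True
    have "\<gamma> / 2 * (norm (u - q))\<^sup>2
        = \<gamma> / 2 * (norm (z - q))\<^sup>2 + \<gamma> * ((z - q) \<bullet> (u - z)) + \<gamma> / 2 * (norm (u - z))\<^sup>2"
      by (rule half_square_expand)
    moreover have "p z - (c + \<gamma> *\<^sub>R (z - q)) \<bullet> (u - z) + \<mu> / 2 * (norm (u - z))\<^sup>2 \<le> p u"
      using assms(1) True by (simp add: prox_point_def)
    moreover have "0 < \<mu> / 2 * (norm (u - z))\<^sup>2" "0 \<le> \<gamma> / 2 * (norm (u - z))\<^sup>2"
      using mu_pos that assms(2) by auto
    moreover have "(c + \<gamma> *\<^sub>R (z - q)) \<bullet> (u - z) = c \<bullet> u - c \<bullet> z + \<gamma> * ((z - q) \<bullet> (u - z))"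
      by (simp add: inner_add_left inner_diff_right algebra_simps)
    ultimately have "c \<bullet> z + \<gamma> / 2 * (norm (z - q))\<^sup>2 + p z < c \<bullet> u + \<gamma> / 2 * (norm (u - q))\<^sup>2 + p u"
      by linarith
    then show ?thesis
      using assms(1) True by (simp add: prox_obj_finite prox_point_def)
  next
    case False
    then show ?thesis
      using assms(1) by (simp add: prox_obj_infinite prox_obj_finite prox_point_def)
  qed
  then have "is_arg_min (prox_obj c \<gamma> q) (\<lambda>_. True) u \<longleftrightarrow> u = z" for u
    by (metis is_arg_min_def order.asym)
  then show ?thesis
    by (simp add: arg_min_def)
qed

lemma prox_pointI_interior:
  assumes "z \<in> edom \<pi>" "z \<in> interior S"
    and "\<And>u. u \<in> S \<Longrightarrow> prox_obj c \<gamma> q z \<le> prox_obj c \<gamma> q u"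
  shows "prox_point c \<gamma> q z"
proof -
  have "eventually (\<lambda>l. prox_obj c \<gamma> q z \<le> prox_obj c \<gamma> q (z + l *\<^sub>R (u - z))) (at_right 0)" for u
  proof -
    have "((\<lambda>l. z + l *\<^sub>R (u - z)) \<longlongrightarrow> z + 0 *\<^sub>R (u - z)) (at_right 0)"
      by (intro tendsto_intros)
    then have "eventually (\<lambda>l. z + l *\<^sub>R (u - z) \<in> interior S) (at_right 0)"
      using assms(2) by (intro topological_tendstoD) auto
    then show ?thesis
      using assms(3) interior_subset by (auto elim!: eventually_mono)
  qed
  then show ?thesis
    using assms(1) prox_obj_growth unfolding prox_point_def by blast
qed

text \<open>Strong convexity gives coercivity: outside a large ball around \<open>xs\<close> the
  objective is no smaller than at \<open>xs\<close>, so a minimizer over the compact ball is a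
  global one.\<close>

lemma prox_point_exists:
  assumes "\<gamma> \<ge> 0"
  shows "\<exists>z. prox_point c \<gamma> q z"
proof -
  \<comment> \<open>\<open>v\<close> is the slope at \<open>xs\<close> of a lower bound for the
    proximal objective. Beyond distance \<open>R\<close> the term \<mu>/2 times the squared distance
    dominates this slope.\<close>
  define v where "v = c - G xs + \<gamma> *\<^sub>R (xs - q)"
  define R where "R = 2 * norm v / \<mu>"
  have "R \<ge> 0"
    using mu_pos by (simp add: R_def)
  obtain z where z: "z \<in> cball xs R" "z \<in> edom \<pi>"
    "\<And>u. u \<in> cball xs R \<Longrightarrow> prox_obj c \<gamma> q z \<le> prox_obj c \<gamma> q u"
    using prox_obj_attains [of "cball xs R" c \<gamma> q] \<open>R \<ge> 0\<close> by auto
  have "prox_obj c \<gamma> q z \<le> prox_obj c \<gamma> q u" for u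
  proof (cases "u \<in> edom \<pi> \<and> u \<notin> cball xs R")
    case True
    define d where "d = u - xs"
    have "R < norm d"
      using True by (simp add: d_def dist_norm norm_minus_commute)
    then have "norm v * norm d \<le> \<mu> / 2 * norm d * norm d"
      using mu_pos by (intro mult_right_mono) (auto simp: R_def field_simps)
    then have "- (\<mu> / 2 * (norm d)\<^sup>2) \<le> v \<bullet> d"
      using Cauchy_Schwarz_ineq2 [of v d] by (simp add: power2_eq_square)
    moreover have "p xs - G xs \<bullet> d + \<mu> / 2 * (norm d)\<^sup>2 \<le> p u"
      using xs_growth [of u] True by (simp add: d_def)
    moreover have "c \<bullet> u = c \<bullet> xs + c \<bullet> d"
      by (simp add: d_def inner_diff_right)
    moreover note half_square_expand [of \<gamma> u q xs, folded d_def]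
    moreover have "0 \<le> \<gamma> / 2 * (norm d)\<^sup>2"
      using assms by auto
    moreover have "v \<bullet> d = c \<bullet> d - G xs \<bullet> d + \<gamma> * ((xs - q) \<bullet> d)"
      by (simp add: v_def inner_add_left inner_diff_left)
    ultimately have "c \<bullet> xs + \<gamma> / 2 * (norm (xs - q))\<^sup>2 + p xs \<le> c \<bullet> u + \<gamma> / 2 * (norm (u - q))\<^sup>2 + p u"
      by linarith
    then have "prox_obj c \<gamma> q xs \<le> prox_obj c \<gamma> q u"
      using True xs_dom by (simp add: prox_obj_finite)
    with z(3) [of xs] \<open>R \<ge> 0\<close> show ?thesis
      by (auto intro: order_trans)
  next
    case False
    then show ?thesis
      using z(3) prox_obj_infinite [of u] by force
  qed
  then have "prox_point c \<gamma> q z"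
    using z(2) by (intro prox_pointI_interior [where S = UNIV]) auto
  then show ?thesis ..
qed

lemma prox_point_ARG_MIN:
  assumes "\<gamma> \<ge> 0"
  shows "prox_point c \<gamma> q (ARG_MIN (prox_obj c \<gamma> q) u. True)"
  using prox_point_exists [OF assms, of c q] prox_point_eq_ARG_MIN [OF _ assms] by metis

end

section \<open>Algebra of the step size\<close>

lemma agls_alpha_fixpoint:
  assumes "0 < \<mu>" "0 < L" "t = 1 \<or> b = \<mu>"
  shows "agls_alpha (\<lambda>l. sqrt (\<mu> / (l + \<mu>))) \<mu> t b L = sqrt (\<mu> / (L + \<mu>))"
proof (cases "t = 1")
  case False
  define c where "c = \<mu> / (L + \<mu>)"
  have c: "0 < c" "c < 1"
    using assms by (auto simp: c_def)
  \<comment> \<open>For \<open>b = \<mu>\<close> the linear term of the quadratic vanishes; its only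
    positive root is below 1, so that \<open>THE\<close> is well defined.\<close>
  have "(L + \<mu>) * a\<^sup>2 + (b - \<mu>) * a - b = 0 \<longleftrightarrow> a\<^sup>2 = c" for a
    using assms False by (auto simp: c_def eq_divide_eq mult.commute)
  moreover have "0 < a \<and> a < 1 \<and> a\<^sup>2 = c \<longleftrightarrow> a = sqrt c" for a
    using c by (auto simp: real_sqrt_unique)
  ultimately show ?thesis
    using False unfolding agls_alpha_def c_def [symmetric] by simp
qed (simp add: agls_alpha_def)

text \<open>The choice of \<open>a\<close> makes \<open>a\<^sup>2 (L + \<mu>) = \<mu>\<close>, which eliminates \<open>L\<close> from the step parameters.\<close>

locale step_size =
  fixes \<mu> L a :: real
  assumes mu_pos: "0 < \<mu>" and L_pos: "0 < L" and a_eq: "a = sqrt (\<mu> / (L + \<mu>))"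
begin

lemma a_pos: "0 < a" and a_less_1: "a < 1"
  using mu_pos L_pos by (auto simp: a_eq)

lemma a_square: "a\<^sup>2 * (L + \<mu>) = \<mu>"
  using mu_pos L_pos by (simp add: a_eq)

lemma gamma_eq: "a * agls_gamma \<mu> L a = \<mu> * (1 - a)"
  using a_square by (simp add: agls_gamma_def power2_eq_square algebra_simps)

lemma gamma_nonneg: "0 \<le> agls_gamma \<mu> L a"
proof -
  have "0 \<le> a * agls_gamma \<mu> L a"
    unfolding gamma_eq using mu_pos a_less_1 by simp
  then show ?thesis
    using a_pos by (simp add: zero_le_mult_iff)
qed

lemma La_square: "L * a\<^sup>2 = \<mu> * (1 - a) * (1 + a)"
  using a_square by (simp add: power2_eq_square algebra_simps)

text \<open>Dividing \<open>La_square\<close> by \<open>gamma_eq\<close> gives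
  \<open>agls_gamma \<mu> L a = L * a / (1 + a)\<close>, that is, the extrapolation weight \<beta>
  is \<open>1 / (1 + a)\<close>.\<close>

lemma a_beta_eq: "a * agls_beta \<mu> L a = a / (1 + a)"
proof -
  have "(L * a\<^sup>2) * (1 / (1 + a)) = a * agls_gamma \<mu> L a"
    unfolding La_square gamma_eq using a_pos by simp
  then have "a * (L * a / (1 + a)) = a * agls_gamma \<mu> L a"
    by (simp add: power2_eq_square ac_simps)
  then have "agls_gamma \<mu> L a = L * a / (1 + a)"
    by (metis a_pos less_irrefl mult_left_cancel)
  then show ?thesis
    using a_pos L_pos by (simp add: agls_beta_def)
qed

text \<open>The right-hand side shows the extrapolated point as a convex combination of
  \<open>y\<close> and \<open>z\<close>.\<close>

lemma extrapolation_eq: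
  "(1 - a) *\<^sub>R y + a *\<^sub>R ((1 - agls_beta \<mu> L a) *\<^sub>R y + agls_beta \<mu> L a *\<^sub>R z)
    = (1 - a / (1 + a)) *\<^sub>R y + (a / (1 + a)) *\<^sub>R z" for y z :: "'b::real_vector"
proof -
  have "?thesis \<longleftrightarrow> (1 - a * agls_beta \<mu> L a) *\<^sub>R y + (a * agls_beta \<mu> L a) *\<^sub>R z
     = (1 - a / (1 + a)) *\<^sub>R y + (a / (1 + a)) *\<^sub>R z"
    by (simp add: algebra_simps)
  then show ?thesis
    unfolding a_beta_eq by simp
qed

text \<open>Multiplied by \<open>1 + a\<close>, the displacement becomes \<open>a\<close> times
  \<open>(w - z) + a *\<^sub>R (w - y)\<close>. Convexity of the squared norm with weights 1 and
  \<open>a\<close> splits it, and \<open>La_square\<close> removes the factors \<open>1 + a\<close>.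
  The two resulting squares match the proximal term and the strong convexity gain in the energy
  estimate.\<close>

lemma step_norm_le:
  fixes y z w :: "'b::real_inner"
  assumes x: "x = (1 - a / (1 + a)) *\<^sub>R y + (a / (1 + a)) *\<^sub>R z"
  shows "L * (norm ((1 - a) *\<^sub>R y + a *\<^sub>R w - x))\<^sup>2
    \<le> \<mu> * (1 - a) * ((norm (w - z))\<^sup>2 + a * (norm (w - y))\<^sup>2)"
proof -
  define N where "N = (norm ((1 - a) *\<^sub>R y + a *\<^sub>R w - x))\<^sup>2"
  define M where "M = (norm ((w - z) + a *\<^sub>R (w - y)))\<^sup>2"
  define Q where "Q = (norm (w - z))\<^sup>2 + a * (norm (w - y))\<^sup>2"
  have "(1 + a) *\<^sub>R x = ((1 + a) * (1 - a / (1 + a))) *\<^sub>R y + ((1 + a) * (a / (1 + a))) *\<^sub>R z"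
    unfolding x by (simp add: scaleR_add_right)
  also have "\<dots> = y + a *\<^sub>R z"
    using a_pos by (simp add: right_diff_distrib)
  finally have "(1 + a) *\<^sub>R ((1 - a) *\<^sub>R y + a *\<^sub>R w - x)
      = (1 + a) *\<^sub>R ((1 - a) *\<^sub>R y + a *\<^sub>R w) - (y + a *\<^sub>R z)"
    by (simp only: scaleR_diff_right)
  also have "\<dots> = a *\<^sub>R ((w - z) + a *\<^sub>R (w - y))"
    by (simp add: algebra_simps)
  finally have "(norm ((1 + a) *\<^sub>R ((1 - a) *\<^sub>R y + a *\<^sub>R w - x)))\<^sup>2
      = (norm (a *\<^sub>R ((w - z) + a *\<^sub>R (w - y))))\<^sup>2"
    by simp
  then have N: "(1 + a)\<^sup>2 * N = a\<^sup>2 * M"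
    by (simp only: norm_scaleR power_mult_distrib power2_abs N_def M_def)
  \<comment> \<open>The exact defect in that convexity inequality, a nonnegative multiple of a
    square.\<close>
  have "M + a * (norm ((w - z) - (w - y)))\<^sup>2 = (1 + a) * Q"
    unfolding power2_norm_eq_inner M_def Q_def
    by (simp add: inner_add_left inner_add_right inner_diff_left inner_diff_right inner_commute
        algebra_simps)
  moreover have "0 \<le> a * (norm ((w - z) - (w - y)))\<^sup>2"
    using a_pos by simp
  ultimately have M: "M \<le> (1 + a) * Q"
    by linarith
  have "(1 + a)\<^sup>2 * (L * N) = (L * a\<^sup>2) * M"
    using N by (simp add: mult.left_commute mult.assoc)
  also have "\<dots> \<le> (L * a\<^sup>2) * ((1 + a) * Q)"
    using M L_pos by (intro mult_left_mono) auto
  also have "\<dots> = (1 + a)\<^sup>2 * (\<mu> * (1 - a) * Q)"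
    unfolding La_square by (simp add: power2_eq_square)
  finally show ?thesis
    unfolding N_def [symmetric] Q_def [symmetric] using a_pos by simp
qed

end

context composite_problem
begin

section \<open>Decrease of the energy\<close>

definition energy :: "'a \<Rightarrow> 'a \<Rightarrow> real" where
  "energy y z = g y + p y - (g xs + p xs) + \<mu> / 2 * (norm (z - xs))\<^sup>2"

lemma energy_ge_z:
  assumes "y \<in> edom \<pi>"
  shows "\<mu> / 2 * (norm (z - xs))\<^sup>2 \<le> energy y z"
proof -
  have "0 \<le> \<mu> / 2 * (norm (y - xs))\<^sup>2"
    using mu_pos by simp
  with objective_growth [OF assms] show ?thesis
    unfolding energy_def by linarith
qed

lemma energy_ge_y:
  assumes "y \<in> edom \<pi>"
  shows "\<mu> / 2 * (norm (y - xs))\<^sup>2 \<le> energy y z"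
proof -
  have "0 \<le> \<mu> / 2 * (norm (z - xs))\<^sup>2"
    using mu_pos by simp
  with objective_growth [OF assms] show ?thesis
    unfolding energy_def by linarith
qed

lemma energy_le_imp_cball:
  assumes "y \<in> edom \<pi>" "0 \<le> D" "energy y z \<le> \<mu> / 2 * D\<^sup>2"
  shows "y \<in> cball xs D" "z \<in> cball xs D"
proof -
  have "u \<in> cball xs D" if "\<mu> / 2 * (norm (u - xs))\<^sup>2 \<le> energy y z" for u
  proof -
    have "\<mu> / 2 * (norm (u - xs))\<^sup>2 \<le> \<mu> / 2 * D\<^sup>2"
      using that assms(3) by (rule order_trans)
    then show ?thesis
      using mu_pos assms(2) by (simp add: dist_norm norm_minus_commute)
  qed
  then show "y \<in> cball xs D" "z \<in> cball xs D"
    using energy_ge_y energy_ge_z assms(1) by blast+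
qed

text \<open>Optimality of \<open>w\<close> is only needed for comparison with \<open>xs\<close>, so that the lemma also covers the
  proximal step constrained to a ball around \<open>xs\<close>.\<close>

lemma energy_decrease:
  assumes "step_size \<mu> L a" and dom: "y \<in> edom \<pi>" "w \<in> edom \<pi>"
    and x: "x = (1 - a / (1 + a)) *\<^sub>R y + (a / (1 + a)) *\<^sub>R z"
    and y': "y' = (1 - a) *\<^sub>R y + a *\<^sub>R w"
    and accept: "g y' \<le> g x + G x \<bullet> (y' - x) + L / 2 * (norm (y' - x))\<^sup>2"
    and opt: "p w - (G x + agls_gamma \<mu> L a *\<^sub>R (w - z)) \<bullet> (xs - w) + \<mu> / 2 * (norm (xs - w))\<^sup>2 \<le> p xs"
  shows "y' \<in> edom \<pi>" "energy y' w \<le> (1 - a) * energy y z"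
proof -
  interpret step_size \<mu> L a by fact
  show "y' \<in> edom \<pi>"
    unfolding y' using a_pos a_less_1
    by (intro strongly_convex_real(1) [OF pi_proper pi_convex dom]) auto
  define A where "A = (norm (w - z))\<^sup>2"
  define B where "B = (norm (w - y))\<^sup>2"
  define Z where "Z = (norm (z - xs))\<^sup>2"
  define W where "W = (norm (w - xs))\<^sup>2"
  have "p y' \<le> (1 - a) * p y + a * p w - \<mu> / 2 * a * (1 - a) * B"
    unfolding y' B_def norm_minus_commute [of w y] using a_pos a_less_1
    by (intro strongly_convex_real(2) [OF pi_proper pi_convex dom]) auto
  \<comment> \<open>The quadratic error of the test splits in two: the \<open>B\<close> part cancels
    the gain in the bound on \<open>p y'\<close>, the \<open>A\<close> part the proximal term
    below.\<close>
  moreover have "L / 2 * (norm (y' - x))\<^sup>2 \<le> \<mu> / 2 * (1 - a) * A + \<mu> / 2 * a * (1 - a) * B"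
  proof -
    have "L * (norm (y' - x))\<^sup>2 \<le> \<mu> * (1 - a) * (A + a * B)"
      using step_norm_le [OF x, of w] unfolding y' A_def B_def .
    then have "L / 2 * (norm (y' - x))\<^sup>2 \<le> \<mu> * (1 - a) * (A + a * B) / 2"
      by simp
    also have "\<dots> = \<mu> / 2 * (1 - a) * A + \<mu> / 2 * a * (1 - a) * B"
      by (simp add: field_simps)
    finally show ?thesis .
  qed
  moreover have "a * (p w + G x \<bullet> (w - x)) + a * agls_gamma \<mu> L a * ((A + W - Z) / 2) + a * (\<mu> / 2 * W)
      \<le> a * (p xs + G x \<bullet> (xs - x))"
  proof -
    \<comment> \<open>With coefficient 2 the expansion is the three-point identity, which trades the
      inner product for squared distances.\<close>
    have "Z = A + 2 * ((w - z) \<bullet> (xs - w)) + W"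
      using half_square_expand [of 2 xs z w] by (simp add: A_def Z_def W_def norm_minus_commute)
    then have "(w - z) \<bullet> (xs - w) = - ((A + W - Z) / 2)"
      by simp
    then have "(G x + agls_gamma \<mu> L a *\<^sub>R (w - z)) \<bullet> (xs - w)
        = G x \<bullet> (xs - w) - agls_gamma \<mu> L a * ((A + W - Z) / 2)"
      by (simp only: inner_add_left inner_scaleR_left)
    moreover have "G x \<bullet> (xs - w) = G x \<bullet> (xs - x) - G x \<bullet> (w - x)"
      by (simp add: inner_diff_right)
    ultimately have "p w + G x \<bullet> (w - x) + agls_gamma \<mu> L a * ((A + W - Z) / 2) + \<mu> / 2 * W
      \<le> p xs + G x \<bullet> (xs - x)"
      using opt unfolding W_def norm_minus_commute [of w xs] by linarith
    then show ?thesis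
      using a_pos by (simp only: distrib_left [symmetric] mult.assoc mult_le_cancel_left_pos)
  qed
  \<comment> \<open>After \<open>gamma_eq\<close> the coefficients of \<open>W\<close> add up to
    \<mu>/2 and \<open>Z\<close> carries (1 - a) \<mu>/2, exactly as in the two energies.\<close>
  then have "a * (p w + G x \<bullet> (w - x)) + \<mu> * (1 - a) * ((A + W - Z) / 2) + a * (\<mu> / 2 * W)
      \<le> a * (p xs + G x \<bullet> (xs - x))"
    unfolding gamma_eq .
  moreover have "(1 - a) * (g x + G x \<bullet> (y - x)) \<le> (1 - a) * g y"
    using a_less_1 convex_on_gradient_inequality [OF g_convex G_gderiv] by (intro mult_left_mono) auto
  moreover have "a * (g x + G x \<bullet> (xs - x)) \<le> a * g xs"
    using a_pos convex_on_gradient_inequality [OF g_convex G_gderiv] by (intro mult_left_mono) auto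
  moreover have "y' - x = (1 - a) *\<^sub>R (y - x) + a *\<^sub>R (w - x)"
    by (simp add: y' algebra_simps)
  then have "G x \<bullet> (y' - x) = (1 - a) * (G x \<bullet> (y - x)) + a * (G x \<bullet> (w - x))"
    by (simp add: inner_add_right)
  ultimately show "energy y' w \<le> (1 - a) * energy y z"
    using accept unfolding energy_def Z_def [symmetric] W_def [symmetric]
    by (simp add: algebra_simps add_divide_distrib diff_divide_distrib)
qed

end

section \<open>Smoothness bounds on a ball\<close>

lemma L2_star_upper:
  fixes \<L> :: "'a::euclidean_space \<Rightarrow> 'a \<Rightarrow> real"
  assumes "generalized_smooth g G \<L>" "u \<in> cball c r" "v \<in> cball c r"
  shows "2 * \<L> u v \<le> L2_star \<L> c r"
proof -
  have "continuous_on (cball c r \<times> cball c r) (\<lambda>z. 2 * (\<lambda>(x, y). \<L> x y) z)"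
    using assms(1) unfolding generalized_smooth_def
    by (intro continuous_intros) (auto intro: continuous_on_subset)
  then have "compact ((\<lambda>z. 2 * (\<lambda>(x, y). \<L> x y) z) ` (cball c r \<times> cball c r))"
    by (intro compact_continuous_image compact_Times) auto
  \<comment> \<open>Boundedness is what makes the real supremum an upper bound; it comes from
    continuity on a compact product.\<close>
  then have "bdd_above ((\<lambda>(x, y). 2 * \<L> x y) ` (cball c r \<times> cball c r))"
    by (auto simp: case_prod_unfold intro: bounded_imp_bdd_above compact_imp_bounded)
  from cSUP_upper [OF _ this, of "(u, v)"] show ?thesis
    using assms by (simp add: L2_star_def)
qed

text \<open>The gradient inequality at \<open>v\<close> involves \<L> only at the pair
  \<open>u\<close>, \<open>v\<close>, whereas integration along the segment would bring in
  intermediate points. The price is the factor 1 in place of 1/2, whence the 2 in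
  \<open>L2_star\<close>.\<close>

lemma convex_smooth_upper_bound:
  assumes "convex_on UNIV g" "generalized_smooth g G \<L>"
  shows "g v \<le> g u + G u \<bullet> (v - u) + \<L> u v * (norm (v - u))\<^sup>2"
proof -
  have "g v + G v \<bullet> (u - v) \<le> g u"
    using assms by (intro convex_on_gradient_inequality) (auto simp: generalized_smooth_def)
  moreover have "(G v - G u) \<bullet> (v - u) \<le> \<L> u v * (norm (v - u))\<^sup>2"
  proof -
    have "(G v - G u) \<bullet> (v - u) \<le> norm (G v - G u) * norm (v - u)"
      by (rule norm_cauchy_schwarz)
    also have "\<dots> \<le> \<L> u v * norm (v - u) * norm (v - u)"
      using assms(2) by (intro mult_right_mono) (auto simp: generalized_smooth_def)
    finally show ?thesis
      by (simp add: power2_eq_square mult.assoc)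
  qed
  ultimately show ?thesis
    by (simp add: inner_diff_left inner_diff_right)
qed

context composite_problem
begin

section \<open>Trial steps\<close>

definition trial :: "nat \<Rightarrow> 'a agls_state \<Rightarrow> real \<Rightarrow> 'a agls_state" where
  "trial = agls_trial G \<pi> \<mu> (\<lambda>l. sqrt (\<mu> / (l + \<mu>)))"

context
  fixes t s L a s'
  assumes L_pos: "0 < L" and b: "t = 1 \<or> st_b s = \<mu>"
  defines "a \<equiv> sqrt (\<mu> / (L + \<mu>))" and "s' \<equiv> trial t s L"
begin

interpretation step_size \<mu> L a
  by unfold_locales (auto simp: mu_pos L_pos a_def)

lemma trial_alpha: "agls_alpha (\<lambda>l. sqrt (\<mu> / (l + \<mu>))) \<mu> t (st_b s) L = a"
  unfolding a_def by (rule agls_alpha_fixpoint [OF mu_pos L_pos b])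

lemma trial_L: "st_L s' = L"
  by (simp add: s'_def trial_def agls_trial_def Let_def)

lemma trial_b: "st_b s' = \<mu>"
  by (simp add: s'_def trial_def agls_trial_def Let_def trial_alpha a_square)

lemma trial_x: "st_x s' = (1 - a / (1 + a)) *\<^sub>R st_y s + (a / (1 + a)) *\<^sub>R st_z s"
  unfolding extrapolation_eq [symmetric]
  by (simp add: s'_def trial_def agls_trial_def Let_def trial_alpha)

lemma trial_z: "st_z s' = (ARG_MIN (prox_obj (G (st_x s')) (agls_gamma \<mu> L a) (st_z s)) u. True)"
  by (simp add: s'_def trial_def agls_trial_def Let_def trial_alpha prox_obj_def [abs_def])

lemma trial_y: "st_y s' = (1 - a) *\<^sub>R st_y s + a *\<^sub>R st_z s'"
  by (simp add: s'_def trial_def agls_trial_def Let_def trial_alpha)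

lemma trial_prox_point: "prox_point (G (st_x s')) (agls_gamma \<mu> L a) (st_z s) (st_z s')"
  unfolding trial_z by (rule prox_point_ARG_MIN [OF gamma_nonneg])

lemma trial_x_in_convex:
  assumes "convex S" "st_y s \<in> S" "st_z s \<in> S"
  shows "st_x s' \<in> S"
  unfolding trial_x using a_pos assms by (intro convexD) auto

lemma trial_energy:
  assumes "st_y s \<in> edom \<pi>" "agls_accept g G s'"
  shows "st_y s' \<in> edom \<pi>" "energy (st_y s') (st_z s') \<le> (1 - a) * energy (st_y s) (st_z s)"
proof -
  note prox = trial_prox_point [unfolded prox_point_def]
  have "g (st_y s') \<le> g (st_x s') + G (st_x s') \<bullet> (st_y s' - st_x s')
      + L / 2 * (norm (st_y s' - st_x s'))\<^sup>2"
    using assms(2) by (simp add: agls_accept_def trial_L)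
  note * = energy_decrease [OF step_size_axioms assms(1) _ trial_x trial_y this]
  show "st_y s' \<in> edom \<pi>" "energy (st_y s') (st_z s') \<le> (1 - a) * energy (st_y s) (st_z s)"
    using prox xs_dom by (auto intro!: *)
qed

lemma trial_accepted:
  assumes y: "st_y s \<in> edom \<pi>" and D: "0 \<le> D" "energy (st_y s) (st_z s) \<le> \<mu> / 2 * D\<^sup>2"
    and L: "L2_star \<L> xs D \<le> L"
  shows "agls_accept g G s'"
proof (cases "D = 0")
  case True
  have yz: "st_y s = xs" "st_z s = xs"
    using energy_le_imp_cball [OF y D] True by auto
  then have x: "st_x s' = xs"
    using trial_x_in_convex [of "{xs}"] by auto
  have "prox_point (G xs) (agls_gamma \<mu> L a) xs xs"
    using xs_dom xs_growth by (simp add: prox_point_def)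
  then have "st_z s' = xs"
    unfolding trial_z x yz by (rule prox_point_eq_ARG_MIN [OF _ gamma_nonneg])
  then have "st_y s' = xs"
    unfolding trial_y yz by (simp add: algebra_simps)
  with x show ?thesis
    by (simp add: agls_accept_def)
next
  case False
  let ?B = "cball xs D" and ?x = "st_x s'" and ?\<gamma> = "agls_gamma \<mu> L a"
  have ball: "st_y s \<in> ?B" "st_z s \<in> ?B"
    using energy_le_imp_cball [OF y D] by auto
  then have x: "?x \<in> ?B"
    by (intro trial_x_in_convex) auto
  \<comment> \<open>\<open>w\<close> solves the constrained problem; that it equals
    \<open>st_z s'\<close> is established only at the end.\<close>
  obtain w where w: "w \<in> ?B" "w \<in> edom \<pi>"
    "\<And>u. u \<in> ?B \<Longrightarrow> prox_obj (G ?x) ?\<gamma> (st_z s) w \<le> prox_obj (G ?x) ?\<gamma> (st_z s) u"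
    using prox_obj_attains [of ?B "G ?x" ?\<gamma> "st_z s"] D(1) by auto
  define v where "v = (1 - a) *\<^sub>R st_y s + a *\<^sub>R w"
  have "v \<in> ?B"
    unfolding v_def using a_pos a_less_1 ball w(1) by (intro convexD) auto
  have "g v \<le> g ?x + G ?x \<bullet> (v - ?x) + \<L> ?x v * (norm (v - ?x))\<^sup>2"
    by (rule convex_smooth_upper_bound [OF g_convex g_smooth])
  also have "\<L> ?x v * (norm (v - ?x))\<^sup>2 \<le> L / 2 * (norm (v - ?x))\<^sup>2"
    using L2_star_upper [OF g_smooth x \<open>v \<in> ?B\<close>] L by (intro mult_right_mono) auto
  finally have accept: "g v \<le> g ?x + G ?x \<bullet> (v - ?x) + L / 2 * (norm (v - ?x))\<^sup>2"
    by simp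
  \<comment> \<open>The segment from \<open>w\<close> to \<open>xs\<close> stays in the ball, so
    constrained optimality already yields the comparison with \<open>xs\<close>.\<close>
  have "eventually (\<lambda>l. l \<in> {0<..<1::real}) (at_right 0)"
    by (rule eventually_at_right_real) simp
  then have "eventually (\<lambda>l. prox_obj (G ?x) ?\<gamma> (st_z s) w
      \<le> prox_obj (G ?x) ?\<gamma> (st_z s) (w + l *\<^sub>R (xs - w))) (at_right 0)"
  proof (rule eventually_mono)
    fix l :: real
    assume "l \<in> {0<..<1}"
    then have "(1 - l) *\<^sub>R w + l *\<^sub>R xs \<in> ?B"
      using w(1) D(1) by (intro convexD) auto
    then show "prox_obj (G ?x) ?\<gamma> (st_z s) w \<le> prox_obj (G ?x) ?\<gamma> (st_z s) (w + l *\<^sub>R (xs - w))"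
      by (intro w(3)) (simp add: algebra_simps)
  qed
  then have "p w - (G ?x + ?\<gamma> *\<^sub>R (w - st_z s)) \<bullet> (xs - w) + \<mu> / 2 * (norm (xs - w))\<^sup>2 \<le> p xs"
    by (rule prox_obj_growth [OF w(2) xs_dom])
  note dec = energy_decrease [OF step_size_axioms y w(2) trial_x v_def accept this]
  have "\<mu> / 2 * (norm (w - xs))\<^sup>2 \<le> energy v w"
    by (rule energy_ge_z [OF dec(1)])
  also have "\<dots> \<le> (1 - a) * energy (st_y s) (st_z s)"
    by (rule dec(2))
  also have "\<dots> \<le> (1 - a) * (\<mu> / 2 * D\<^sup>2)"
    using D(2) a_less_1 by (intro mult_left_mono) auto
  \<comment> \<open>Strictness, from \<open>a > 0\<close> and \<open>D \<noteq> 0\<close>, puts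
    \<open>w\<close> in the open ball and so makes the constraint inactive.\<close>
  also have "\<dots> < \<mu> / 2 * D\<^sup>2"
    using False a_pos mu_pos by simp
  finally have "(norm (w - xs))\<^sup>2 < D\<^sup>2"
    using mu_pos by simp
  then have "w \<in> interior ?B"
    using D(1) by (simp add: dist_norm norm_minus_commute power_less_imp_less_base)
  then have "prox_point (G ?x) ?\<gamma> (st_z s) w"
    using w by (intro prox_pointI_interior [where S = ?B]) auto
  then have "st_z s' = w"
    unfolding trial_z by (rule prox_point_eq_ARG_MIN [OF _ gamma_nonneg])
  then have "st_y s' = v"
    by (simp add: trial_y v_def)
  with accept show ?thesis
    by (simp add: agls_accept_def trial_L)
qed

end

end

section \<open>The iteration\<close>

locale agls_run = composite_problem g G \<pi> \<L> \<mu> xs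
  for g :: "'a::euclidean_space \<Rightarrow> real" and G \<pi> \<L> \<mu> xs +
  fixes L0 \<tau>\<^sub>d \<tau>\<^sub>u :: real and x0 :: 'a and T :: nat
  assumes x0_dom: "x0 \<in> edom \<pi>" and L0_pos: "0 < L0"
    and tau: "0 < \<tau>\<^sub>d" "\<tau>\<^sub>d < 1" "1 < \<tau>\<^sub>u"
    and succeeds: "\<forall>t\<in>{1..T}. agls_succeeds g G \<pi> \<mu> L0 \<tau>\<^sub>d \<tau>\<^sub>u (\<lambda>l. sqrt (\<mu> / (l + \<mu>))) x0 t"
begin

definition state :: "nat \<Rightarrow> 'a agls_state" where
  "state = agls g G \<pi> \<mu> L0 \<tau>\<^sub>d \<tau>\<^sub>u (\<lambda>l. sqrt (\<mu> / (l + \<mu>))) x0"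

text \<open>The index \<open>t\<close> is that of the state from which the search starts, so these
  are the trial values of iteration \<open>Suc t\<close>.\<close>

definition trial_L :: "nat \<Rightarrow> nat \<Rightarrow> real" where
  "trial_L t k = \<tau>\<^sub>d * st_L (state t) * \<tau>\<^sub>u ^ k"

abbreviation rate :: "nat \<Rightarrow> real" where
  "rate t \<equiv> sqrt (\<mu> / (st_L (state t) + \<mu>))"

lemma state_0:
  "st_x (state 0) = x0" "st_y (state 0) = x0" "st_z (state 0) = x0" "st_L (state 0) = L0"
  by (simp_all add: state_def)

text \<open>Success of the search makes the \<open>LEAST\<close> exponent pass the test; the
  rejection of all smaller exponents is what later bounds the estimate.\<close>

lemma state_Suc:
  assumes "t < T"
  obtains k where "state (Suc t) = trial (Suc t) (state t) (trial_L t k)"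
    "agls_accept g G (state (Suc t))"
    "\<And>j. j < k \<Longrightarrow> \<not> agls_accept g G (trial (Suc t) (state t) (trial_L t j))"
proof -
  define P where "P k \<longleftrightarrow> agls_accept g G (trial (Suc t) (state t) (trial_L t k))" for k
  have "\<exists>k. P k"
    using bspec [OF succeeds, of "Suc t"] assms
    by (simp add: P_def agls_succeeds_def agls_search_def trial_def state_def trial_L_def)
  then have least: "P (LEAST k. P k)"
    by (rule LeastI_ex)
  have eq: "state (Suc t) = trial (Suc t) (state t) (trial_L t (LEAST k. P k))"
    unfolding P_def by (simp only: state_def agls.simps Let_def agls_search_def trial_def trial_L_def)
  show ?thesis
  proof (rule that [OF eq])
    show "agls_accept g G (state (Suc t))"
      using least unfolding eq P_def .
    show "\<not> agls_accept g G (trial (Suc t) (state t) (trial_L t j))" if "j < (LEAST k. P k)" for j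
      using not_less_Least [OF that] unfolding P_def .
  qed
qed

text \<open>The conjuncts go through one induction: positivity and \<open>st_b = \<mu>\<close> fix
  the step size, and the domain condition feeds the contraction. The alternative
  \<open>t = 0\<close> is there because the initial \<open>st_b\<close> is 0.\<close>

lemma state_invariant:
  assumes "t \<le> T"
  shows "0 < st_L (state t) \<and> (t = 0 \<or> st_b (state t) = \<mu>) \<and> st_y (state t) \<in> edom \<pi> \<and>
    energy (st_y (state t)) (st_z (state t)) \<le> (\<Prod>i=1..t. 1 - rate i) * energy x0 x0"
  using assms
proof (induction t)
  case 0
  then show ?case
    by (simp add: state_0 L0_pos x0_dom)
next
  case (Suc t)
  then have "t < T"
    by simp
  from state_Suc [OF this] obtain k where k: "state (Suc t) = trial (Suc t) (state t) (trial_L t k)"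
    "agls_accept g G (state (Suc t))" .
  have IH: "0 < st_L (state t)" "t = 0 \<or> st_b (state t) = \<mu>" "st_y (state t) \<in> edom \<pi>"
    "energy (st_y (state t)) (st_z (state t)) \<le> (\<Prod>i=1..t. 1 - rate i) * energy x0 x0"
    using Suc by auto
  have pos: "0 < trial_L t k"
    using IH(1) tau by (simp add: trial_L_def)
  have b: "Suc t = 1 \<or> st_b (state t) = \<mu>"
    using IH(2) by auto
  have L: "st_L (state (Suc t)) = trial_L t k" "st_b (state (Suc t)) = \<mu>"
    unfolding k by (rule trial_L [OF pos b] trial_b [OF pos b])+
  have "st_y (state (Suc t)) \<in> edom \<pi>"
    unfolding k by (rule trial_energy(1) [OF pos b IH(3) k(2) [unfolded k(1)]])
  moreover have "energy (st_y (state (Suc t))) (st_z (state (Suc t)))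
      \<le> (1 - rate (Suc t)) * energy (st_y (state t)) (st_z (state t))"
    unfolding L unfolding k by (rule trial_energy(2) [OF pos b IH(3) k(2) [unfolded k(1)]])
  moreover have "\<dots> \<le> (1 - rate (Suc t)) * ((\<Prod>i=1..t. 1 - rate i) * energy x0 x0)"
    using IH(4) pos mu_pos by (intro mult_left_mono) (auto simp: L)
  ultimately show ?case
    using pos L by (simp add: mult.assoc mult.left_commute)
qed

end

section \<open>Confinement of the iterates and growth of the Lipschitz estimate\<close>

context agls_run
begin

lemma rate_bounds:
  assumes "t \<le> T"
  shows "0 < rate t" "rate t < 1"
  using state_invariant [OF assms] mu_pos by simp_all

lemma energy_bound:
  assumes "t \<le> T" "energy x0 x0 \<le> \<mu> / 2 * D\<^sup>2"
  shows "energy (st_y (state t)) (st_z (state t)) \<le> \<mu> / 2 * D\<^sup>2"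
proof -
  have "0 \<le> 1 - rate i" "1 - rate i \<le> 1" if "i \<in> {1..t}" for i
    using rate_bounds [of i] that assms(1) by auto
  then have "(\<Prod>i=1..t. 1 - rate i) \<le> 1"
    by (intro prod_le_1) blast
  moreover have "0 \<le> energy x0 x0"
    using mu_pos by (intro order_trans [OF _ energy_ge_z [OF x0_dom]]) simp
  ultimately have "(\<Prod>i=1..t. 1 - rate i) * energy x0 x0 \<le> 1 * energy x0 x0"
    by (intro mult_right_mono)
  with state_invariant [OF assms(1)] assms(2) show ?thesis
    by linarith
qed

text \<open>The energy controls \<open>y\<close> and \<open>z\<close>; each later \<open>x\<close>
  is a convex combination of the preceding \<open>y\<close> and \<open>z\<close>, and the initial
  \<open>x\<close> equals \<open>y\<close>.\<close>

lemma iterates_in_cball: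
  assumes "0 \<le> D" "energy x0 x0 \<le> \<mu> / 2 * D\<^sup>2" "t \<le> T"
  shows "st_x (state t) \<in> cball xs D \<and> st_y (state t) \<in> cball xs D \<and> st_z (state t) \<in> cball xs D"
proof -
  have yz: "st_y (state t) \<in> cball xs D" "st_z (state t) \<in> cball xs D" if "t \<le> T" for t
    using energy_le_imp_cball [OF _ assms(1) energy_bound [OF that assms(2)]] state_invariant [OF that]
    by auto
  have "st_x (state t) \<in> cball xs D"
  proof (cases t)
    case 0
    then show ?thesis
      using yz(1) [OF assms(3)] by (simp add: state_0)
  next
    case (Suc n)
    then have "n < T"
      using assms(3) by simp
    from state_Suc [OF this] obtain k
      where k: "state (Suc n) = trial (Suc n) (state n) (trial_L n k)" .
    have inv: "0 < st_L (state n)" "n = 0 \<or> st_b (state n) = \<mu>"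
      using state_invariant [of n] \<open>n < T\<close> by auto
    show ?thesis
      unfolding Suc k using inv tau yz [of n] \<open>n < T\<close>
      by (intro trial_x_in_convex) (auto simp: trial_L_def)
  qed
  with yz assms(3) show ?thesis
    by auto
qed

text \<open>Either the first trial value is accepted, which the third hypothesis covers, or the
  value before the accepted one was rejected. By \<open>trial_accepted\<close> that one lies below
  \<open>L2_star \<L> xs D\<close>, and one factor \<open>\<tau>\<^sub>u\<close> leads to the
  accepted value.\<close>

lemma st_L_Suc_le:
  assumes D: "0 \<le> D" "energy x0 x0 \<le> \<mu> / 2 * D\<^sup>2"
    and "\<tau>\<^sub>d * st_L (state t) \<le> \<tau>\<^sub>u * L2_star \<L> xs D" and "t < T"
  shows "st_L (state (Suc t)) \<le> \<tau>\<^sub>u * L2_star \<L> xs D"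
proof -
  from state_Suc [OF \<open>t < T\<close>] obtain k
    where k: "state (Suc t) = trial (Suc t) (state t) (trial_L t k)"
      and reject: "\<And>j. j < k \<Longrightarrow> \<not> agls_accept g G (trial (Suc t) (state t) (trial_L t j))"
    by metis
  have inv: "0 < st_L (state t)" "Suc t = 1 \<or> st_b (state t) = \<mu>" "st_y (state t) \<in> edom \<pi>"
    using state_invariant [of t] \<open>t < T\<close> by auto
  have pos: "0 < trial_L t j" for j
    using inv(1) tau by (simp add: trial_L_def)
  have L: "st_L (state (Suc t)) = trial_L t k"
    unfolding k by (rule trial_L [OF pos inv(2)])
  show ?thesis
  proof (cases k)
    case 0
    then show ?thesis
      using assms(3) by (simp add: L trial_L_def)
  next
    case (Suc j)
    have "trial_L t j < L2_star \<L> xs D"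
    proof (rule ccontr)
      assume "\<not> ?thesis"
      then have "agls_accept g G (trial (Suc t) (state t) (trial_L t j))"
        using energy_bound [of t D] \<open>t < T\<close> D
        by (intro trial_accepted [OF pos inv(2,3) D(1)]) auto
      then show False
        using reject Suc by simp
    qed
    then have "\<tau>\<^sub>u * trial_L t j \<le> \<tau>\<^sub>u * L2_star \<L> xs D"
      using tau by simp
    then show ?thesis
      by (simp add: L trial_L_def Suc mult_ac)
  qed
qed

text \<open>The condition on \<open>L0\<close> serves the first iteration, whose first trial value
  is \<open>\<tau>\<^sub>d * L0\<close>; afterwards \<open>\<tau>\<^sub>d < 1\<close> preserves the
  bound.\<close>

lemma st_L_le:
  assumes D: "0 \<le> D" "energy x0 x0 \<le> \<mu> / 2 * D\<^sup>2"
    and L0: "\<tau>\<^sub>d * L0 \<le> \<tau>\<^sub>u * L2_star \<L> xs D"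
    and "t < T"
  shows "st_L (state (Suc t)) \<le> \<tau>\<^sub>u * L2_star \<L> xs D"
  using \<open>t < T\<close>
proof (induction t)
  case 0
  then show ?case
    using L0 by (intro st_L_Suc_le [OF D]) (auto simp: state_0)
next
  case (Suc t)
  then have "0 < st_L (state (Suc t))"
    using state_invariant [of "Suc t"] by auto
  then have "\<tau>\<^sub>d * st_L (state (Suc t)) \<le> 1 * st_L (state (Suc t))"
    using tau by (intro mult_right_mono) auto
  with Suc show ?case
    by (intro st_L_Suc_le [OF D]) auto
qed

text \<open>The rate decreases in the estimate, so \<open>st_L_le\<close> bounds every rate below by
  the same \<open>q\<close>, and 1 - q is at most exp (- q).\<close>

lemma prod_rate_le:
  assumes D: "0 \<le> D" "energy x0 x0 \<le> \<mu> / 2 * D\<^sup>2"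
    and L0: "\<tau>\<^sub>d * L0 \<le> \<tau>\<^sub>u * L2_star \<L> xs D"
  shows "(\<Prod>t=1..T. 1 - rate t) \<le> exp (- sqrt (\<mu> / (\<tau>\<^sub>u * L2_star \<L> xs D + \<mu>)) * real T)"
proof -
  let ?q = "sqrt (\<mu> / (\<tau>\<^sub>u * L2_star \<L> xs D + \<mu>))"
  have "0 \<le> 1 - rate t \<and> 1 - rate t \<le> exp (- ?q)" if "t \<in> {1..T}" for t
  proof -
    have "st_L (state t) \<le> \<tau>\<^sub>u * L2_star \<L> xs D"
      using st_L_le [OF D L0, of "t - 1"] that by auto
    moreover have "0 < st_L (state t)"
      using state_invariant [of t] that by auto
    ultimately have "?q \<le> rate t"
      using mu_pos by (intro real_sqrt_le_mono divide_left_mono) auto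
    moreover have "1 + (- ?q) \<le> exp (- ?q)"
      by (rule exp_ge_add_one_self)
    moreover have "rate t < 1"
      using rate_bounds [of t] that by auto
    ultimately show ?thesis
      by (intro conjI) linarith+
  qed
  then have "(\<Prod>t=1..T. 1 - rate t) \<le> (\<Prod>t=1..T. exp (- ?q))"
    by (rule prod_mono)
  also have "\<dots> = exp (- ?q * real T)"
    by (simp add: exp_of_nat_mult [symmetric] mult.commute)
  finally show ?thesis .
qed

end

text \<open>The exponential bound carries the condition
  \<open>\<tau>\<^sub>d * L0 \<le> \<tau>\<^sub>u * L2\<close>: a larger first trial value passes
  the test at once by \<open>trial_accepted\<close>, and the estimate then exceeds the bound from
  which the rate comes.\<close>

theorem theorem6p2:
  fixes g :: "'a::euclidean_space \<Rightarrow> real" and G :: "'a \<Rightarrow> 'a"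
    and \<pi> :: "'a \<Rightarrow> ereal" and \<L> :: "'a \<Rightarrow> 'a \<Rightarrow> real"
    and \<mu> L0 \<tau>\<^sub>d \<tau>\<^sub>u D L2 :: real and x0 xs :: 'a and T :: nat
    and \<alpha>1 :: "real \<Rightarrow> real" and \<psi> :: "'a \<Rightarrow> ereal"
    and x y z :: "nat \<Rightarrow> 'a" and L :: "nat \<Rightarrow> real"
  assumes "convex_on UNIV g" and "generalized_smooth g G \<L>"
    and "proper \<pi>" and "lower_semicontinuous \<pi>" and "\<mu> > 0" and "strongly_convex \<mu> \<pi>"
    and "x0 \<in> edom \<pi>" and "L0 > 0" and "0 < \<tau>\<^sub>d" and "\<tau>\<^sub>d < 1" and "\<tau>\<^sub>u > 1"
  defines "\<psi> \<equiv> (\<lambda>u. ereal (g u) + \<pi> u)"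
    and "\<alpha>1 \<equiv> (\<lambda>l. sqrt (\<mu> / (l + \<mu>)))"
  defines "x \<equiv> (\<lambda>t. st_x (agls g G \<pi> \<mu> L0 \<tau>\<^sub>d \<tau>\<^sub>u \<alpha>1 x0 t))"
    and "y \<equiv> (\<lambda>t. st_y (agls g G \<pi> \<mu> L0 \<tau>\<^sub>d \<tau>\<^sub>u \<alpha>1 x0 t))"
    and "z \<equiv> (\<lambda>t. st_z (agls g G \<pi> \<mu> L0 \<tau>\<^sub>d \<tau>\<^sub>u \<alpha>1 x0 t))"
    and "L \<equiv> (\<lambda>t. st_L (agls g G \<pi> \<mu> L0 \<tau>\<^sub>d \<tau>\<^sub>u \<alpha>1 x0 t))"
    and "D \<equiv> D2_star \<mu> \<psi> x0 xs"
  defines "L2 \<equiv> L2_star \<L> xs D"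
  assumes "is_arg_min \<psi> (\<lambda>_. True) xs"
    and "\<forall>t\<in>{1..T}. agls_succeeds g G \<pi> \<mu> L0 \<tau>\<^sub>d \<tau>\<^sub>u \<alpha>1 x0 t"
  shows "(\<forall>t\<le>T. x t \<in> cball xs D \<and> y t \<in> cball xs D \<and> z t \<in> cball xs D)
    \<and> \<psi> (y T) - \<psi> xs + ereal (\<mu> / 2 * (norm (z T - xs))\<^sup>2)
        \<le> ereal (\<Prod>t=1..T. 1 - sqrt (\<mu> / (L t + \<mu>)))
            * (\<psi> x0 - \<psi> xs + ereal (\<mu> / 2 * (norm (x0 - xs))\<^sup>2))
    \<and> (\<tau>\<^sub>d * L0 \<le> \<tau>\<^sub>u * L2 \<longrightarrow>
        ereal (\<Prod>t=1..T. 1 - sqrt (\<mu> / (L t + \<mu>)))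
            * (\<psi> x0 - \<psi> xs + ereal (\<mu> / 2 * (norm (x0 - xs))\<^sup>2))
        \<le> ereal (2 * exp (- sqrt (\<mu> / (\<tau>\<^sub>u * L2 + \<mu>)) * real T)) * (\<psi> x0 - \<psi> xs))"
proof -
  interpret agls_run g G \<pi> \<L> \<mu> xs L0 \<tau>\<^sub>d \<tau>\<^sub>u x0 T
    using assms by unfold_locales (simp_all add: \<psi>_def \<alpha>1_def)
  have run: "x = (\<lambda>t. st_x (state t))" "y = (\<lambda>t. st_y (state t))" "z = (\<lambda>t. st_z (state t))"
    "L = (\<lambda>t. st_L (state t))"
    by (simp_all add: x_def y_def z_def L_def state_def \<alpha>1_def)
  define \<Delta> where "\<Delta> = g x0 + p x0 - (g xs + p xs)"
  have gap: "\<psi> u - \<psi> xs = ereal (g u + p u - (g xs + p xs))" if "u \<in> edom \<pi>" for u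
    unfolding \<psi>_def using pi_eq [OF that] pi_eq [OF xs_dom]
    by (metis plus_ereal.simps(1) ereal_minus(1))
  have gap0: "\<psi> x0 - \<psi> xs = ereal \<Delta>"
    using gap [OF x0_dom] by (simp add: \<Delta>_def)
  have "energy x0 x0 = \<Delta> + \<mu> / 2 * (norm (x0 - xs))\<^sup>2"
    by (simp add: energy_def \<Delta>_def)
  \<comment> \<open>Quadratic growth at \<open>x0\<close> absorbs the distance term into the gap;
    this is the source of the factor 2 in the final bound.\<close>
  moreover have "\<mu> / 2 * (norm (x0 - xs))\<^sup>2 \<le> \<Delta>"
    using objective_growth [OF x0_dom] by (simp add: \<Delta>_def)
  moreover have "0 \<le> \<mu> / 2 * (norm (x0 - xs))\<^sup>2"
    using mu_pos by simp
  ultimately have energy0: "energy x0 x0 = \<Delta> + \<mu> / 2 * (norm (x0 - xs))\<^sup>2"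
    "0 \<le> energy x0 x0" "energy x0 x0 \<le> 2 * \<Delta>" "0 \<le> \<Delta>"
    by linarith+
  have "D = sqrt (2 / \<mu> * energy x0 x0)"
    unfolding D_def D2_star_def gap0 energy0(1) using mu_pos by (simp add: field_simps)
  then have D: "0 \<le> D" "energy x0 x0 = \<mu> / 2 * D\<^sup>2"
    using mu_pos energy0(2) by simp_all
  have "x t \<in> cball xs D \<and> y t \<in> cball xs D \<and> z t \<in> cball xs D" if "t \<le> T" for t
    using iterates_in_cball [OF D(1) eq_refl [OF D(2)] that] by (simp add: run)
  moreover have "\<psi> (y T) - \<psi> xs + ereal (\<mu> / 2 * (norm (z T - xs))\<^sup>2)
      \<le> ereal (\<Prod>t=1..T. 1 - sqrt (\<mu> / (L t + \<mu>)))
        * (\<psi> x0 - \<psi> xs + ereal (\<mu> / 2 * (norm (x0 - xs))\<^sup>2))"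
  proof -
    have "y T \<in> edom \<pi>" "energy (y T) (z T) \<le> (\<Prod>t=1..T. 1 - rate t) * energy x0 x0"
      using state_invariant [of T] by (auto simp: run)
    then show ?thesis
      by (simp add: gap gap0 energy0(1) energy_def run \<Delta>_def)
  qed
  moreover have "ereal (\<Prod>t=1..T. 1 - sqrt (\<mu> / (L t + \<mu>)))
        * (\<psi> x0 - \<psi> xs + ereal (\<mu> / 2 * (norm (x0 - xs))\<^sup>2))
      \<le> ereal (2 * exp (- sqrt (\<mu> / (\<tau>\<^sub>u * L2 + \<mu>)) * real T)) * (\<psi> x0 - \<psi> xs)"
    if "\<tau>\<^sub>d * L0 \<le> \<tau>\<^sub>u * L2"
  proof -
    have "(\<Prod>t=1..T. 1 - rate t) \<le> exp (- sqrt (\<mu> / (\<tau>\<^sub>u * L2 + \<mu>)) * real T)"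
      using prod_rate_le [OF D(1) eq_refl [OF D(2)] that [unfolded L2_def]] by (simp add: L2_def)
    then have "(\<Prod>t=1..T. 1 - rate t) * energy x0 x0
        \<le> exp (- sqrt (\<mu> / (\<tau>\<^sub>u * L2 + \<mu>)) * real T) * (2 * \<Delta>)"
      using energy0 by (intro mult_mono) auto
    then show ?thesis
      by (simp add: gap0 energy0(1) run mult_ac)
  qed
  ultimately show ?thesis
    by blast
qed

end
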